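(* Let $\mathcal{H}\cong\mathbb{C}^n$, let $\mathbf{H}$ be self-adjoint on $\mathcal{H}$, let $\alpha_1,\dots,\alpha_{n^2-1}$ and $\beta$ be non-negative real numbers, let $\{p_j\}_{j=1}^r$ with $r\le n^2-1$ be a probability vector, let $\{\mathbf{w}_j\}_{j=1}^{n^2-1}$ be a set of self-adjoint operators on $\mathcal{H}$ orthonormal for the trace inner product, and let $\mathbf{U}_1,\dots,\mathbf{U}_r$ be unitary operators on $\mathcal{H}$. Let $\Gamma$ be the GKLS vector field on $\mathfrak{T}_1$ of the quantum random unitary semigroup with generator $$\mathbf{L}(\xi)=-2[[\mathbf{H},\xi]]-\mathbf{V}\odot\xi+\sum_{j=1}^{n^2-1}\alpha_j\,\mathbf{w}_j\,\xi\,\mathbf{w}_j+\beta\sum_{j=1}^{r}p_j\,\mathbf{U}_j\,\xi\,\mathbf{U}_j^\dagger,\qquad \mathbf{V}=\sum_{j=1}^{n^2-1}\alpha_j\mathbf{w}_j^2+\beta\,\mathbb{I}.$$ Then the function $F(\xi)=\frac12\mathrm{Tr}(\xi^2)$ is a LaSalle function for $\Gamma$.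
   Context: $\mathfrak{O}^*$ is the space of self-adjoint $n\times n$ matrices (identified with the dual of the space $\mathfrak{O}$ of self-adjoint operators on $\mathcal{H}$ via the trace), $\mathfrak{T}_1=\{\xi\in\mathfrak{O}^*:\mathrm{Tr}\,\xi=1\}$, and $\mathcal{S}\subset\mathfrak{T}_1$ is the compact set of quantum states (positive semidefinite matrices of trace $1$). $\mathbf{a}\odot\mathbf{b}=\frac12(\mathbf{ab}+\mathbf{ba})$, $[[\mathbf{a},\mathbf{b}]]=\frac i2(\mathbf{ab}-\mathbf{ba})$. The GKLS vector field $\Gamma$ of a (traceless-valued) generator $\mathbf{L}$ is the vector field on the affine space $\mathfrak{T}_1$ whose value at $\xi$ is $\mathbf{L}(\xi)$. LaSalle function: let $\Gamma$ be a complete smooth vector field on $\mathfrak{T}_1$ whose flow maps $\mathcal{S}$ into itself for all times $\tau\ge0$ (GKLS vector fields have this property, since $e^{\tau\mathbf{L}}$ is completely positive and trace preserving for $\tau\ge0$). A function $F:\mathfrak{T}_1\to\mathbb{R}$ is a LaSalle function for $\Gamma$ if $F$ is smooth, $F\ge0$ on $\mathcal{S}$, and the Lie derivative satisfies $\mathcal{L}_\Gamma F\le0$ at every point of $\mathcal{S}$. *)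

theory Defs
  imports "HOL-Analysis.Analysis"
begin

type_synonym 'n cmat = "complex ^ 'n ^ 'n"

definition dagger :: "'n::finite cmat \<Rightarrow> 'n cmat" where
  "dagger A = (\<chi> i j. cnj (A $ j $ i))"

definition self_adjoint :: "'n::finite cmat \<Rightarrow> bool" where
  "self_adjoint A \<longleftrightarrow> dagger A = A"

definition unitary :: "'n::finite cmat \<Rightarrow> bool" where
  "unitary U \<longleftrightarrow> dagger U ** U = mat 1 \<and> U ** dagger U = mat 1"

definition cinner :: "complex ^ 'n::finite \<Rightarrow> complex ^ 'n \<Rightarrow> complex" where
  "cinner v w = (\<Sum>i\<in>UNIV. cnj (v $ i) * w $ i)"

text \<open>For self-adjoint \<open>A\<close> the number \<open>cinner v (A *v v)\<close> is real, so taking the real part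
  loses nothing.\<close>

definition pos_semidef :: "'n::finite cmat \<Rightarrow> bool" where
  "pos_semidef A \<longleftrightarrow> self_adjoint A \<and> (\<forall>v. 0 \<le> Re (cinner v (A *v v)))"

definition jordan_prod :: "'n::finite cmat \<Rightarrow> 'n cmat \<Rightarrow> 'n cmat" (infixl "\<odot>" 70) where
  "a \<odot> b = (1 / 2) *\<^sub>R (a ** b + b ** a)"

text \<open>The bracket \<open>(i/2) (ab - ba)\<close>.\<close>

definition lie_prod :: "'n::finite cmat \<Rightarrow> 'n cmat \<Rightarrow> 'n cmat" where
  "lie_prod a b = (\<chi> k l. (\<i> / 2) * (a ** b - b ** a) $ k $ l)"

definition trace_one :: "'n::finite cmat set" where
  "trace_one = {\<xi>. self_adjoint \<xi> \<and> trace \<xi> = 1}"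

definition states :: "'n::finite cmat set" where
  "states = {\<xi> \<in> trace_one. pos_semidef \<xi>}"

text \<open>Smoothness of maps on an affine subspace \<open>M\<close>. Derivatives are taken within \<open>M\<close>, so only the
  values of \<open>f\<close> on \<open>M\<close> matter. The derivative \<open>f' x\<close> is a linear map on the ambient space that is
  determined only on the direction space of \<open>M\<close>; every such derivative extends linearly by a
  fixed projection, so requiring regularity of \<open>f' x v\<close> for all ambient vectors \<open>v\<close> imposes
  nothing beyond regularity of the directional derivatives along \<open>M\<close>.\<close>

fun Ck_on :: "nat \<Rightarrow> 'a::euclidean_space set \<Rightarrow> ('a \<Rightarrow> 'b::real_normed_vector) \<Rightarrow> bool" where
  "Ck_on 0 M f \<longleftrightarrow> continuous_on M f"
| "Ck_on (Suc k) M f \<longleftrightarrow>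
     (\<exists>f'. (\<forall>x\<in>M. (f has_derivative f' x) (at x within M)) \<and> (\<forall>v. Ck_on k M (\<lambda>x. f' x v)))"

definition smooth_on :: "'a::euclidean_space set \<Rightarrow> ('a \<Rightarrow> 'b::real_normed_vector) \<Rightarrow> bool" where
  "smooth_on M f \<longleftrightarrow> (\<forall>k. Ck_on k M f)"

text \<open>The tangent space of the affine subspace \<open>M\<close> at each of its points is its direction space
  \<open>{x - y | x y. x \<in> M \<and> y \<in> M}\<close>.\<close>

definition smooth_vector_field_on :: "'a::euclidean_space set \<Rightarrow> ('a \<Rightarrow> 'a) \<Rightarrow> bool" where
  "smooth_vector_field_on M X \<longleftrightarrow>
     smooth_on M X \<and> X ` M \<subseteq> {x - y | x y. x \<in> M \<and> y \<in> M}"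

definition integral_curve_on :: "'a::euclidean_space set \<Rightarrow> ('a \<Rightarrow> 'a) \<Rightarrow> (real \<Rightarrow> 'a) \<Rightarrow> bool" where
  "integral_curve_on M X \<gamma> \<longleftrightarrow>
     (\<forall>t. \<gamma> t \<in> M \<and> (\<gamma> has_vector_derivative X (\<gamma> t)) (at t))"

definition complete_on :: "'a::euclidean_space set \<Rightarrow> ('a \<Rightarrow> 'a) \<Rightarrow> bool" where
  "complete_on M X \<longleftrightarrow> (\<forall>x\<in>M. \<exists>\<gamma>. integral_curve_on M X \<gamma> \<and> \<gamma> 0 = x)"

text \<open>The time-\<open>\<tau>\<close> flow of a complete smooth field sends \<open>\<gamma> 0\<close> to \<open>\<gamma> \<tau>\<close> for each
  (unique) integral curve \<open>\<gamma>\<close>.\<close>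

definition flow_preserves :: "'a::euclidean_space set \<Rightarrow> ('a \<Rightarrow> 'a) \<Rightarrow> 'a set \<Rightarrow> bool" where
  "flow_preserves M X S \<longleftrightarrow>
     (\<forall>\<gamma>. integral_curve_on M X \<gamma> \<and> \<gamma> 0 \<in> S \<longrightarrow> (\<forall>\<tau>\<ge>0. \<gamma> \<tau> \<in> S))"

definition lie_derivative :: "('a::euclidean_space \<Rightarrow> 'a) \<Rightarrow> ('a \<Rightarrow> real) \<Rightarrow> 'a \<Rightarrow> real" where
  "lie_derivative X F x = deriv (\<lambda>t. F (x + t *\<^sub>R X x)) 0"

text \<open>The first three conjuncts are the conditions on the field under which the notion of a LaSalle
  function is introduced.\<close>

definition lasalle_function :: "('n::finite cmat \<Rightarrow> 'n cmat) \<Rightarrow> ('n cmat \<Rightarrow> real) \<Rightarrow> bool" where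
  "lasalle_function X F \<longleftrightarrow>
     smooth_vector_field_on trace_one X \<and>
     complete_on trace_one X \<and>
     flow_preserves trace_one X states \<and>
     smooth_on trace_one F \<and>
     (\<forall>\<xi>\<in>states. 0 \<le> F \<xi>) \<and>
     (\<forall>\<xi>\<in>states. lie_derivative X F \<xi> \<le> 0)"

definition random_unitary_generator ::
  "'n::finite cmat \<Rightarrow> (nat \<Rightarrow> real) \<Rightarrow> (nat \<Rightarrow> 'n cmat) \<Rightarrow>
   real \<Rightarrow> nat \<Rightarrow> (nat \<Rightarrow> real) \<Rightarrow> (nat \<Rightarrow> 'n cmat) \<Rightarrow> 'n cmat \<Rightarrow> 'n cmat" where
  "random_unitary_generator H \<alpha> w \<beta> r p U \<xi> =
     (let V = (\<Sum>j = 1..CARD('n)^2 - 1. \<alpha> j *\<^sub>R (w j ** w j)) + \<beta> *\<^sub>R mat 1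
      in - (2 *\<^sub>R lie_prod H \<xi>) - V \<odot> \<xi>
         + (\<Sum>j = 1..CARD('n)^2 - 1. \<alpha> j *\<^sub>R (w j ** \<xi> ** w j))
         + \<beta> *\<^sub>R (\<Sum>j = 1..r. p j *\<^sub>R (U j ** \<xi> ** dagger (U j))))"

end

theory Submission
  imports Defs
begin

section \<open>Adjoints and inner products of complex matrices\<close>

text \<open>On self-adjoint matrices the function is half the squared norm of the real inner product
  \<open>Re (trace (dagger A ** B))\<close>, so its Lie derivative along a linear field
  \<open>G\<close> is \<open>\<xi> \<bullet> G \<xi>\<close>. As the \<open>p j\<close> sum to one,
  the generator is a non-negative combination of a commutator with a skew-adjoint matrix, double
  commutators, and differences \<open>U ** \<xi> ** dagger U - \<xi>\<close>. For these the pairing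
  is zero, minus half a squared norm, and non-positive by Cauchy-Schwarz.

  The conditions on the field remain. Completeness comes from the exponential series
  (\<open>linear_field_integral_curve\<close>). Invariance of the states is obtained without
  complete positivity of the semigroup: a first-exit argument
  (\<open>unital_generator_preserves_pos\<close>) derives it from conditional positivity, which,
  like dissipativity, is inherited by non-negative combinations. \<open>unital_generator\<close>
  collects these inherited properties.\<close>

lemma dagger_simps [simp]:
  "dagger (dagger A) = A" "dagger (A + B) = dagger A + dagger B"
  "dagger (A - B) = dagger A - dagger B" "dagger (- A) = - dagger A"
  "dagger (c *\<^sub>R A) = c *\<^sub>R dagger A" "dagger 0 = 0" "dagger (mat 1) = mat 1"
  by (auto simp: dagger_def vec_eq_iff mat_def)

lemma dagger_mult [simp]: "dagger (A ** B) = dagger B ** dagger A"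
  by (simp add: dagger_def vec_eq_iff matrix_matrix_mult_def mult.commute)

lemma matrix_mult_simps [simp]:
  fixes A :: "complex ^ 'n::finite ^ 'n"
  shows "(c *\<^sub>R A) ** B = c *\<^sub>R (A ** B)" "A ** (c *\<^sub>R B) = c *\<^sub>R (A ** B)"
    "A ** (- B) = - (A ** B)" "(- A) ** B = - (A ** B)"
  by (simp_all add: vec_eq_iff matrix_matrix_mult_def scaleR_sum_right sum_negf)

lemma matrix_mult_distribs:
  fixes A :: "complex ^ 'n::finite ^ 'n"
  shows "A ** (B + C) = A ** B + A ** C" "(B + C) ** A = B ** A + C ** A"
    "A ** (B - C) = A ** B - A ** C" "(B - C) ** A = B ** A - C ** A"
  by (simp_all add: vec_eq_iff matrix_matrix_mult_def sum.distrib sum_subtractf algebra_simps)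

lemma scaleR_matrix_vector [simp]:
  fixes A :: "complex ^ 'n::finite ^ 'n"
  shows "(c *\<^sub>R A) *v x = c *\<^sub>R (A *v x)" "A *v (c *\<^sub>R x) = c *\<^sub>R (A *v x)"
  by (simp_all add: vec_eq_iff matrix_vector_mult_def scaleR_sum_right)

lemma trace_scaleR [simp]: "trace (c *\<^sub>R (A :: complex ^ 'n::finite ^ 'n)) = c *\<^sub>R trace A"
  by (simp add: trace_def scaleR_sum_right)

lemma sum_matrix_mult:
  fixes A :: "'i \<Rightarrow> complex ^ 'n::finite ^ 'n"
  shows "(\<Sum>j\<in>S. A j) ** B = (\<Sum>j\<in>S. A j ** B)" "B ** (\<Sum>j\<in>S. A j) = (\<Sum>j\<in>S. B ** A j)"
  by (induction S rule: infinite_finite_induct) (simp_all add: matrix_mult_distribs)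

lemma Re_cinner: "Re (cinner v w) = v \<bullet> w"
  by (simp add: cinner_def inner_vec_def inner_complex_def)

lemma inner_matrix_eq_trace: "A \<bullet> B = Re (trace (dagger A ** B))"
proof -
  have "A \<bullet> B = (\<Sum>i\<in>UNIV. \<Sum>j\<in>UNIV. Re (cnj (A $ i $ j) * B $ i $ j))"
    by (simp add: inner_vec_def inner_complex_def)
  also have "\<dots> = (\<Sum>j\<in>UNIV. \<Sum>i\<in>UNIV. Re (cnj (A $ i $ j) * B $ i $ j))"
    by (rule sum.swap)
  finally show ?thesis
    by (simp add: trace_def matrix_matrix_mult_def dagger_def)
qed

lemma inner_matrix_mult_left:
  fixes A B C :: "complex ^ 'n::finite ^ 'n"
  shows "(A ** B) \<bullet> C = B \<bullet> (dagger A ** C)"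
  by (simp add: inner_matrix_eq_trace matrix_mul_assoc)

lemma inner_matrix_mult_right:
  fixes A B C :: "complex ^ 'n::finite ^ 'n"
  shows "(A ** B) \<bullet> C = A \<bullet> (C ** dagger B)"
  by (simp add: inner_matrix_eq_trace trace_mul_sym[of "dagger B"] flip: matrix_mul_assoc)

lemma inner_matrix_vector: "(A *v x) \<bullet> y = x \<bullet> (dagger A *v y)"
proof -
  have "cinner (A *v x) y = (\<Sum>i\<in>UNIV. \<Sum>j\<in>UNIV. cnj (A $ i $ j) * cnj (x $ j) * y $ i)"
    by (simp add: cinner_def matrix_vector_mult_def sum_distrib_right)
  also have "\<dots> = (\<Sum>j\<in>UNIV. \<Sum>i\<in>UNIV. cnj (A $ i $ j) * cnj (x $ j) * y $ i)"
    by (rule sum.swap)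
  also have "\<dots> = cinner x (dagger A *v y)"
    by (simp add: cinner_def matrix_vector_mult_def dagger_def sum_distrib_left mult_ac)
  finally show ?thesis
    by (simp flip: Re_cinner)
qed

lemma pos_semidef_inner:
  "pos_semidef A \<longleftrightarrow> self_adjoint A \<and> (\<forall>v. 0 \<le> v \<bullet> (A *v v))"
  by (simp add: pos_semidef_def Re_cinner)

text \<open>If \<open>u = A *v v\<close> were nonzero, moving from \<open>v\<close> a little way
  along \<open>-u\<close> would make the quadratic form negative, since its first-order change is
  \<open>-2 * s * (u \<bullet> u)\<close>.\<close>

lemma pos_semidef_null_vector:
  assumes A: "pos_semidef A" and v: "v \<bullet> (A *v v) = 0"
  shows "A *v v = 0"
proof (rule ccontr)
  define u where "u = A *v v"
  define a where "a = u \<bullet> u"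
  define b where "b = u \<bullet> (A *v u)"
  assume "A *v v \<noteq> 0"
  then have "a > 0"
    by (simp add: a_def u_def)
  have b: "b \<ge> 0"
    using A by (simp add: b_def pos_semidef_inner)
  have "v \<bullet> (A *v u) = a"
    using A inner_matrix_vector[of A v u]
    by (simp add: a_def u_def pos_semidef_inner self_adjoint_def inner_commute)
  then have expand: "(v - s *\<^sub>R u) \<bullet> (A *v (v - s *\<^sub>R u)) = s * (s * b - 2 * a)" for s
    using v by (simp add: matrix_vector_mult_diff_distrib
        inner_diff_left inner_diff_right b_def algebra_simps a_def flip: u_def)
  \<comment> \<open>Any \<open>s > 0\<close> with \<open>s * b < 2 * a\<close> serves; the
    \<open>+ 1\<close> covers \<open>b = 0\<close>.\<close>
  define s where "s = a / (b + 1)"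
  have "s > 0" "s * b < 2 * a"
    using \<open>a > 0\<close> b by (auto simp: s_def field_simps intro: add_strict_increasing2)
  then have "s * (s * b - 2 * a) < 0"
    by (simp add: mult_pos_neg)
  then show False
    using A expand[of s] by (metis pos_semidef_inner not_less)
qed

lemma self_adjoint_inner_trace:
  "self_adjoint A \<Longrightarrow> Re (trace (A ** B)) = A \<bullet> B"
  by (simp add: inner_matrix_eq_trace self_adjoint_def)

section \<open>Smooth maps and linear vector fields\<close>

lemma Ck_on_bounded_linear:
  assumes "bounded_linear f"
  shows "Ck_on k M f"
proof (cases k)
  case 0
  then show ?thesis
    using assms by (simp add: linear_continuous_on)
next
  case (Suc m)
  have const: "Ck_on j M (\<lambda>_. c)" for j and c :: 'b
    by (induction j arbitrary: c) (auto intro!: exI[of _ "\<lambda>_ _. 0"])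
  show ?thesis
    using assms const bounded_linear_imp_has_derivative
    by (auto simp: Suc intro!: exI[of _ "\<lambda>_. f"])
qed

text \<open>Each directional derivative is linear in the base point, so
  \<open>Ck_on_bounded_linear\<close> handles all higher orders and no induction is
  required.\<close>

lemma smooth_on_inner_self:
  fixes M :: "'a::euclidean_space set"
  shows "smooth_on M (\<lambda>x. c * (x \<bullet> x))"
  unfolding smooth_on_def
proof
  fix k
  show "Ck_on k M (\<lambda>x. c * (x \<bullet> x))"
  proof (cases k)
    case 0
    then show ?thesis
      by (auto intro!: continuous_intros)
  next
    case (Suc m)
    have lin: "Ck_on m M (\<lambda>x. c * (x \<bullet> v + v \<bullet> x))" for v
      by (rule Ck_on_bounded_linear) (intro bounded_linear_intros)
    have "((\<lambda>x. c * (x \<bullet> x)) has_derivative (\<lambda>v. c * (x \<bullet> v + v \<bullet> x))) (at x within M)" for x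
      by (auto intro!: derivative_eq_intros)
    with lin show ?thesis
      by (auto simp: Suc intro!: exI[of _ "\<lambda>x v. c * (x \<bullet> v + v \<bullet> x)"])
  qed
qed

text \<open>Derivatives are taken within \<open>M\<close>. This matters because the trace function
  equals half the squared norm on self-adjoint matrices but not on the whole ambient space.\<close>

lemma smooth_on_cong:
  assumes "smooth_on M f" and eq: "\<And>x. x \<in> M \<Longrightarrow> f x = g x"
  shows "smooth_on M g"
  unfolding smooth_on_def
proof
  fix k
  have f: "Ck_on k M f"
    using assms by (simp add: smooth_on_def)
  show "Ck_on k M g"
  proof (cases k)
    case 0
    with f eq show ?thesis
      using continuous_on_cong[of M M f g] by simp
  next
    case (Suc m)
    with f obtain f' where f': "\<And>x. x \<in> M \<Longrightarrow> (f has_derivative f' x) (at x within M)"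
      "\<And>v. Ck_on m M (\<lambda>x. f' x v)"
      by auto
    then have "(g has_derivative f' x) (at x within M)" if "x \<in> M" for x
      using that eq by (metis has_derivative_transform)
    with f' show ?thesis
      by (auto simp: Suc)
  qed
qed

text \<open>The curve is \<open>exp (t G) x\<close>, written as a power series because operators on a Euclidean
  space do not form an instance of a Banach algebra.\<close>

lemma linear_field_integral_curve:
  fixes G :: "'a::euclidean_space \<Rightarrow> 'a"
  assumes G: "linear G" and W: "subspace W"
    and GW: "\<And>y. y - x \<in> W \<Longrightarrow> G y \<in> W"
  obtains \<gamma> where "\<gamma> 0 = x" "\<And>t. (\<gamma> has_vector_derivative G (\<gamma> t)) (at t)"
    "\<And>t. \<gamma> t - x \<in> W"
proof -
  obtain K where K: "K > 0" "\<And>y. norm (G y) \<le> K * norm y"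
    using G linear_bounded_pos by blast
  have pow: "norm ((G ^^ n) x) \<le> K ^ n * norm x" for n
  proof (induction n)
    case (Suc n)
    have "norm ((G ^^ Suc n) x) \<le> K * norm ((G ^^ n) x)"
      using K by simp
    also have "\<dots> \<le> K * (K ^ n * norm x)"
      using Suc K by (intro mult_left_mono) auto
    finally show ?case
      by simp
  qed simp
  define expt where "expt t n = (t ^ n /\<^sub>R fact n) *\<^sub>R (G ^^ n) x" for t :: real and n
  define \<gamma> where "\<gamma> t = suminf (expt t)" for t
  have summ: "summable (expt t)" for t
  proof (rule summable_comparison_test')
    show "summable (\<lambda>n. norm x * ((K * \<bar>t\<bar>) ^ n /\<^sub>R fact n))"
      by (intro summable_mult summable_exp_generic)
    fix n
    have "norm (expt t n) \<le> (\<bar>t\<bar> ^ n / fact n) * (K ^ n * norm x)"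
      unfolding expt_def norm_scaleR using pow[of n]
      by (intro mult_mono) (auto simp: power_abs abs_mult divide_inverse_commute)
    then show "norm (expt t n) \<le> norm x * ((K * \<bar>t\<bar>) ^ n /\<^sub>R fact n)"
      by (simp add: power_mult_distrib field_simps)
  qed
  have bl: "bounded_linear G"
    using G by (simp add: linear_conv_bounded_linear)
  have deriv: "(\<gamma> has_vector_derivative G (\<gamma> t)) (at t)" for t
  proof -
    \<comment> \<open>Paired with a fixed \<open>b\<close>, the exponential becomes a real power
      series with coefficients \<open>c n\<close>, which may be differentiated term by term.\<close>
    have "((\<lambda>s. \<gamma> s \<bullet> b) has_real_derivative G (\<gamma> t) \<bullet> b) (at t)" for b
    proof -
      define c where "c n = ((G ^^ n) x \<bullet> b) / fact n" for n
      have inner_expt: "expt s n \<bullet> b = c n * s ^ n" for s n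
        by (simp add: expt_def c_def divide_inverse_commute)
      have sumc: "summable (\<lambda>n. c n * s ^ n)" for s
        using bounded_linear.summable[OF bounded_linear_inner_left[of b] summ[of s]]
        by (simp add: inner_expt)
      have \<gamma>b: "\<gamma> s \<bullet> b = (\<Sum>n. c n * s ^ n)" for s
        using bounded_linear.suminf[OF bounded_linear_inner_left[of b] summ[of s]]
        by (simp add: inner_expt \<gamma>_def)
      have "G (expt t n) \<bullet> b = diffs c n * t ^ n" for n
      proof -
        have "diffs c n = (G ((G ^^ n) x) \<bullet> b) / fact n"
          unfolding diffs_def c_def fact_Suc of_nat_mult by (simp del: of_nat_Suc)
        then show ?thesis
          by (simp add: expt_def linear_cmul[OF G] divide_inverse_commute)
      qed
      moreover have "G (\<gamma> t) \<bullet> b = (\<Sum>n. G (expt t n) \<bullet> b)"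
        unfolding \<gamma>_def bounded_linear.suminf[OF bl summ]
        by (rule bounded_linear.suminf[OF bounded_linear_inner_left])
          (rule bounded_linear.summable[OF bl summ])
      ultimately show ?thesis
        using termdiffs_strong_converges_everywhere[of c t] sumc by (simp add: \<gamma>b)
    qed
    then show ?thesis
      unfolding has_vector_derivative_def
      by (subst has_derivative_componentwise_within)
        (auto simp: has_field_derivative_def mult_commute_abs)
  qed
  have GxW: "G x \<in> W"
    using GW[of x] W by (simp add: subspace_0)
  have "(G ^^ Suc n) x \<in> W" for n
  proof (induction n)
    case (Suc n)
    \<comment> \<open>\<open>GW\<close> speaks only of points of the affine space
      \<open>x + W\<close>, so the iterate is shifted by \<open>x\<close> and \<open>G x\<close> is
      subtracted afterwards.\<close>
    then have "G ((G ^^ Suc n) x + x) \<in> W"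
      by (intro GW) simp
    then have "G ((G ^^ Suc n) x + x) - G x \<in> W"
      using GxW W subspace_diff by blast
    then show ?case
      by (simp add: linear_add[OF G])
  qed (use GxW in simp)
  then have exptW: "expt t (Suc n) \<in> W" for t n
    unfolding expt_def using W by (intro subspace_scale)
  have "\<gamma> t - x \<in> W" for t
  proof -
    \<comment> \<open>The term of index 0 is \<open>x\<close> itself; all later terms lie in
      \<open>W\<close>, which is closed.\<close>
    have "(\<lambda>n. expt t (Suc n)) sums (\<gamma> t - x)"
      using summable_sums[OF summ[of t]] sums_Suc_iff[of "expt t" "\<gamma> t - x"]
      by (simp add: \<gamma>_def expt_def)
    moreover have "(\<Sum>i<n. expt t (Suc i)) \<in> W" for n
      using W exptW by (intro subspace_sum)
    ultimately show ?thesis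
      unfolding sums_def by (rule closed_sequentially[OF closed_subspace[OF W], rotated])
  qed
  moreover have "\<gamma> 0 = x"
    using suminf_finite[of "{0}" "expt 0"] by (simp add: \<gamma>_def expt_def)
  ultimately show ?thesis
    using that deriv by blast
qed

section \<open>Unital generators of positive semigroups\<close>

text \<open>The last condition is conditional positivity, the infinitesimal form of the invariance of
  the positive cone. These maps form a convex cone, which reduces the random unitary generator
  to its elementary summands.\<close>

definition unital_generator :: "('n::finite cmat \<Rightarrow> 'n cmat) \<Rightarrow> bool" where
  "unital_generator G \<longleftrightarrow>
     linear G \<and>
     (\<forall>\<xi>. self_adjoint \<xi> \<longrightarrow> self_adjoint (G \<xi>)) \<and>
     (\<forall>\<xi>. trace (G \<xi>) = 0) \<and>
     G (mat 1) = 0 \<and>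
     (\<forall>\<xi>. self_adjoint \<xi> \<longrightarrow> \<xi> \<bullet> G \<xi> \<le> 0) \<and>
     (\<forall>\<xi> v. pos_semidef \<xi> \<longrightarrow> \<xi> *v v = 0 \<longrightarrow> 0 \<le> v \<bullet> (G \<xi> *v v))"

lemma unital_generator_add:
  assumes "unital_generator G" "unital_generator G'"
  shows "unital_generator (\<lambda>\<xi>. G \<xi> + G' \<xi>)"
  using assms
  by (auto simp: unital_generator_def linear_compose_add trace_add inner_add_right
      matrix_vector_mult_add_rdistrib self_adjoint_def intro: add_nonpos_nonpos)

lemma unital_generator_scaleR:
  assumes "unital_generator G" "0 \<le> c"
  shows "unital_generator (\<lambda>\<xi>. c *\<^sub>R G \<xi>)"
  using assms
  by (auto simp: unital_generator_def linear_compose_scale_right self_adjoint_def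
      mult_nonneg_nonpos)

lemma unital_generator_sum:
  assumes "\<And>j. j \<in> S \<Longrightarrow> unital_generator (G j)"
  shows "unital_generator (\<lambda>\<xi>. \<Sum>j\<in>S. G j \<xi>)"
proof -
  have zero: "unital_generator (\<lambda>_. 0)"
    by (simp add: unital_generator_def linear_zero self_adjoint_def trace_def)
  show ?thesis
    using assms
    by (induction S rule: infinite_finite_induct) (auto simp: zero intro: unital_generator_add)
qed

section \<open>Elementary summands of the generator\<close>

text \<open>Multiplication by a skew-adjoint \<open>K\<close> on either side is skew for the inner
  product, so the dissipation vanishes. On a null vector of \<open>\<xi>\<close> the form vanishes
  too, because \<open>\<xi>\<close> can be moved to either side.\<close>

lemma unital_generator_commutator:
  fixes K :: "'n::finite cmat"
  assumes K: "dagger K = - K"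
  shows "unital_generator (\<lambda>\<xi>. K ** \<xi> - \<xi> ** K)"
  unfolding unital_generator_def
proof (intro conjI allI impI)
  show "linear (\<lambda>\<xi>. K ** \<xi> - \<xi> ** K)"
    by (rule linearI) (simp_all add: matrix_mult_distribs scaleR_diff_right)
next
  fix \<xi> :: "'n cmat" assume "self_adjoint \<xi>"
  then show "self_adjoint (K ** \<xi> - \<xi> ** K)"
    by (simp add: self_adjoint_def K)
  show "\<xi> \<bullet> (K ** \<xi> - \<xi> ** K) \<le> 0"
    using inner_matrix_mult_left[of K \<xi> \<xi>] inner_matrix_mult_right[of \<xi> K \<xi>]
    by (simp add: K inner_diff_right inner_commute)
next
  fix \<xi> :: "'n cmat"
  show "trace (K ** \<xi> - \<xi> ** K) = 0"
    by (simp add: trace_sub trace_mul_sym[of K])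
next
  fix \<xi> :: "'n cmat" and v assume "pos_semidef \<xi>" "\<xi> *v v = 0"
  then show "0 \<le> v \<bullet> ((K ** \<xi> - \<xi> ** K) *v v)"
    using inner_matrix_vector[of \<xi> v "K *v v"]
    by (simp add: matrix_vector_mult_diff_rdistrib pos_semidef_def self_adjoint_def
        inner_diff_right flip: matrix_vector_mul_assoc)
qed simp

lemma unital_generator_hamiltonian:
  assumes H: "self_adjoint H"
  shows "unital_generator (\<lambda>\<xi>. - (2 *\<^sub>R lie_prod H \<xi>))"
proof -
  \<comment> \<open>\<open>K\<close> is -i times \<open>H\<close>, which is skew-adjoint.\<close>
  define K where "K = (\<chi> k l. - \<i> * H $ k $ l)"
  have "cnj (H $ j $ i) = H $ i $ j" for i j
    using H by (simp add: self_adjoint_def dagger_def vec_eq_iff)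
  then have "dagger K = - K"
    by (simp add: K_def dagger_def vec_eq_iff)
  moreover have "- (2 *\<^sub>R lie_prod H \<xi>) = K ** \<xi> - \<xi> ** K" for \<xi>
    by (simp add: K_def lie_prod_def vec_eq_iff matrix_matrix_mult_def scaleR_conv_of_real
        sum_distrib_left sum_negf right_diff_distrib mult.left_commute mult.assoc)
  ultimately show ?thesis
    using unital_generator_commutator by simp
qed

lemma jordan_prod_simps:
  "(A + B) \<odot> C = A \<odot> C + B \<odot> C" "(c *\<^sub>R A) \<odot> C = c *\<^sub>R (A \<odot> C)"
  "(\<Sum>j\<in>S. X j) \<odot> C = (\<Sum>j\<in>S. X j \<odot> C)" "mat 1 \<odot> C = C"
  by (simp_all add: jordan_prod_def matrix_mult_distribs sum_matrix_mult scaleR_add_right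
      scaleR_sum_right sum.distrib flip: scaleR_add_left)

text \<open>The map is -1/2 [w, [w, \<xi>]], so its pairing with \<open>\<xi>\<close> is minus half
  the squared norm of [w, \<xi>]. On a null vector \<open>v\<close> of \<open>\<xi>\<close> only the
  sandwich term survives, giving the form of \<open>\<xi>\<close> at \<open>w *v v\<close>.\<close>

lemma unital_generator_double_commutator:
  fixes w :: "'n::finite cmat"
  assumes w: "self_adjoint w"
  shows "unital_generator (\<lambda>\<xi>. w ** \<xi> ** w - (w ** w) \<odot> \<xi>)"
  unfolding unital_generator_def jordan_prod_def
proof (intro conjI allI impI)
  show "linear (\<lambda>\<xi>. w ** \<xi> ** w - (1 / 2) *\<^sub>R (w ** w ** \<xi> + \<xi> ** (w ** w)))"
    by (rule linearI) (simp_all add: matrix_mult_distribs algebra_simps)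
  show "w ** mat 1 ** w - (1 / 2) *\<^sub>R (w ** w ** mat 1 + mat 1 ** (w ** w)) = 0"
    by (simp flip: scaleR_2)
next
  fix \<xi> :: "'n cmat" assume \<xi>: "self_adjoint \<xi>"
  then show "self_adjoint (w ** \<xi> ** w - (1 / 2) *\<^sub>R (w ** w ** \<xi> + \<xi> ** (w ** w)))"
    using w by (simp add: self_adjoint_def matrix_mul_assoc add.commute)
  have "\<xi> \<bullet> (w ** \<xi> ** w) = (w ** \<xi>) \<bullet> (\<xi> ** w)"
    "\<xi> \<bullet> (w ** w ** \<xi>) = (w ** \<xi>) \<bullet> (w ** \<xi>)"
    "\<xi> \<bullet> (\<xi> ** (w ** w)) = (\<xi> ** w) \<bullet> (\<xi> ** w)"
    using w by (simp_all add: inner_matrix_mult_left[of w] inner_matrix_mult_right[of \<xi> w "\<xi> ** w"]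
        self_adjoint_def flip: matrix_mul_assoc)
  moreover have "0 \<le> (w ** \<xi> - \<xi> ** w) \<bullet> (w ** \<xi> - \<xi> ** w)"
    by simp
  ultimately show "\<xi> \<bullet> (w ** \<xi> ** w - (1 / 2) *\<^sub>R (w ** w ** \<xi> + \<xi> ** (w ** w))) \<le> 0"
    by (simp add: inner_diff_right inner_diff_left inner_add_right inner_commute)
next
  fix \<xi> :: "'n cmat"
  show "trace (w ** \<xi> ** w - (1 / 2) *\<^sub>R (w ** w ** \<xi> + \<xi> ** (w ** w))) = 0"
    by (simp add: trace_sub trace_add trace_mul_sym[of _ w] trace_mul_sym[of \<xi>] matrix_mul_assoc)
next
  fix \<xi> :: "'n cmat" and v assume \<xi>: "pos_semidef \<xi>" and v: "\<xi> *v v = 0"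
  have "v \<bullet> (w *v (\<xi> *v (w *v v))) = (w *v v) \<bullet> (\<xi> *v (w *v v))"
    using w inner_matrix_vector[of w v] by (simp add: self_adjoint_def)
  moreover have "v \<bullet> (\<xi> *v (w *v (w *v v))) = 0"
    using \<xi> v inner_matrix_vector[of \<xi> v] by (simp add: pos_semidef_def self_adjoint_def)
  ultimately show
    "0 \<le> v \<bullet> ((w ** \<xi> ** w - (1 / 2) *\<^sub>R (w ** w ** \<xi> + \<xi> ** (w ** w))) *v v)"
    using \<xi> v by (simp add: matrix_vector_mult_diff_rdistrib matrix_vector_mult_add_rdistrib
        inner_diff_right inner_add_right pos_semidef_inner flip: matrix_vector_mul_assoc)
qed

text \<open>Unitary conjugation is an isometry, so Cauchy-Schwarz bounds its pairing with
  \<open>\<xi>\<close> by \<open>\<xi> \<bullet> \<xi>\<close>. On a null vector \<open>v\<close> of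
  \<open>\<xi>\<close> the form of \<open>\<xi>\<close> at \<open>dagger U *v v\<close>
  remains.\<close>

lemma unital_generator_unitary:
  fixes U :: "'n::finite cmat"
  assumes U: "unitary U"
  shows "unital_generator (\<lambda>\<xi>. U ** \<xi> ** dagger U - \<xi>)"
  unfolding unital_generator_def
proof (intro conjI allI impI)
  show "linear (\<lambda>\<xi>. U ** \<xi> ** dagger U - \<xi>)"
    by (rule linearI) (simp_all add: matrix_mult_distribs algebra_simps)
  show "U ** mat 1 ** dagger U - mat 1 = 0"
    using U by (simp add: unitary_def)
next
  fix \<xi> :: "'n cmat" assume \<xi>: "self_adjoint \<xi>"
  then show "self_adjoint (U ** \<xi> ** dagger U - \<xi>)"
    by (simp add: self_adjoint_def matrix_mul_assoc)
  have "(U ** X) \<bullet> (U ** X) = X \<bullet> X" for X :: "'n cmat"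
    using U by (simp add: inner_matrix_mult_left[of U] unitary_def matrix_mul_assoc)
  from this[of "\<xi> ** dagger U"]
  have "(U ** \<xi> ** dagger U) \<bullet> (U ** \<xi> ** dagger U) = (\<xi> ** dagger U) \<bullet> (\<xi> ** dagger U)"
    by (simp add: matrix_mul_assoc)
  also have "\<dots> = \<xi> \<bullet> (\<xi> ** (dagger U ** U))"
    by (simp add: inner_matrix_mult_right[of \<xi> "dagger U"] matrix_mul_assoc)
  also have "\<dots> = \<xi> \<bullet> \<xi>"
    using U by (simp add: unitary_def)
  finally have "norm (U ** \<xi> ** dagger U) = norm \<xi>"
    by (simp add: norm_eq_sqrt_inner)
  then show "\<xi> \<bullet> (U ** \<xi> ** dagger U - \<xi>) \<le> 0"
    using norm_cauchy_schwarz[of \<xi> "U ** \<xi> ** dagger U"]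
    by (simp add: inner_diff_right dot_square_norm power2_eq_square)
next
  fix \<xi> :: "'n cmat"
  show "trace (U ** \<xi> ** dagger U - \<xi>) = 0"
    using U by (simp add: trace_sub trace_mul_sym[of _ "dagger U"] matrix_mul_assoc unitary_def)
next
  fix \<xi> :: "'n cmat" and v assume \<xi>: "pos_semidef \<xi>" and v: "\<xi> *v v = 0"
  have "v \<bullet> (U *v (\<xi> *v (dagger U *v v))) = (dagger U *v v) \<bullet> (\<xi> *v (dagger U *v v))"
    by (simp add: inner_matrix_vector)
  with \<xi> v show "0 \<le> v \<bullet> ((U ** \<xi> ** dagger U - \<xi>) *v v)"
    by (simp add: matrix_vector_mult_diff_rdistrib pos_semidef_inner
        flip: matrix_vector_mul_assoc)
qed

section \<open>Invariance of the positive cone\<close>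

text \<open>Since \<open>G (mat 1) = 0\<close>, the curve \<open>\<eta> t = \<gamma> t + (e * (1 + t)) *\<^sub>R mat 1\<close> has velocity
  \<open>G (\<eta> t) + e *\<^sub>R mat 1\<close>. Where it would first lose positive definiteness it has a null vector, and in
  that direction conditional positivity makes it strictly increasing.\<close>

lemma unital_generator_preserves_pos:
  fixes G :: "'n::finite cmat \<Rightarrow> 'n cmat"
  assumes G: "unital_generator G"
    and \<gamma>': "\<And>t. (\<gamma> has_vector_derivative G (\<gamma> t)) (at t)"
    and sa: "\<And>t. self_adjoint (\<gamma> t)"
    and pos: "pos_semidef (\<gamma> 0)" and T: "0 \<le> T"
  shows "pos_semidef (\<gamma> T)"
proof -
  have perturbed: "0 < u \<bullet> (\<gamma> T *v u) + e * (1 + T)" if e: "0 < e" and u: "norm u = 1" for e u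
  proof (rule ccontr)
    define g where "g t v = v \<bullet> (\<gamma> t *v v) + e * (1 + t) * (v \<bullet> v)" for t v
    \<comment> \<open>\<open>g t\<close> is the quadratic form of the perturbed curve, and
      \<open>D\<close> collects the times and unit directions where strict positivity fails.
      Compactness of \<open>D\<close> supplies an earliest failure \<open>(s, v)\<close>.\<close>
    define D where "D = {p \<in> {0..T} \<times> sphere 0 1. g (fst p) (snd p) \<le> 0}"
    have cont\<gamma>: "continuous_on UNIV \<gamma>"
      using \<gamma>' by (auto intro: continuous_at_imp_continuous_on has_vector_derivative_continuous)
    have contg: "continuous_on UNIV (\<lambda>p. g (fst p) (snd p))"
      unfolding g_def inner_vec_def matrix_vector_mult_def
      by (auto intro!: continuous_intros continuous_on_compose2[OF cont\<gamma>])
    assume "\<not> 0 < u \<bullet> (\<gamma> T *v u) + e * (1 + T)"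
    then have "(T, u) \<in> D"
      using u T by (simp add: D_def g_def dot_square_norm)
    moreover have "compact D"
    proof -
      have "closed ({p. g (fst p) (snd p) \<le> 0})"
        using closed_Collect_le[OF contg continuous_on_const] by simp
      moreover have "D = ({0..T} \<times> sphere 0 1) \<inter> {p. g (fst p) (snd p) \<le> 0}"
        by (auto simp: D_def)
      ultimately show ?thesis
        by (simp add: compact_Int_closed compact_Times)
    qed
    ultimately obtain q where "q \<in> D" and q: "\<And>y. y \<in> D \<Longrightarrow> fst q \<le> fst y"
      using continuous_attains_inf[of D fst] continuous_on_fst[OF continuous_on_id] by (metis empty_iff)
    then obtain s v where sv: "q = (s, v)" "0 \<le> s" "s \<le> T" "norm v = 1" "g s v \<le> 0"
      by (cases q) (auto simp: D_def)
    have before: "0 < g t y" if "0 \<le> t" "t < s" "norm y = 1" for t y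
      using q[of "(t, y)"] sv that by (force simp: D_def)
    have "0 < g 0 v"
      using pos e sv by (simp add: g_def pos_semidef_inner dot_square_norm add_nonneg_pos)
    then have "0 < s"
      using sv by (cases "s = 0") auto
    have cont: "continuous (at s) (\<lambda>t. g t y)" for y
      using continuous_on_compose2[OF contg, of UNIV "\<lambda>t. (t, y)"]
      by (auto simp: continuous_on_eq_continuous_at intro!: continuous_intros)
    \<comment> \<open>At time \<open>s\<close> the form is a left limit of positive values, so the
      perturbed matrix is still positive semidefinite there.\<close>
    have unit: "0 \<le> g s y" if "norm y = 1" for y
    proof (rule tendsto_lowerbound)
      show "((\<lambda>t. g t y) \<longlongrightarrow> g s y) (at_left s)"
        using cont[of y] by (simp add: continuous_within tendsto_within_subset
            filterlim_at_split isCont_def)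
      have "eventually (\<lambda>t. t \<in> {0<..<s}) (at_left s)"
        using \<open>0 < s\<close> eventually_at_left_real by blast
      then show "eventually (\<lambda>t. 0 \<le> g t y) (at_left s)"
        by eventually_elim (use before[of _ y] that less_imp_le in auto)
    qed simp
    define \<eta> where "\<eta> = \<gamma> s + (e * (1 + s)) *\<^sub>R mat 1"
    have \<eta>_inner: "y \<bullet> (\<eta> *v y) = g s y" for y
      by (simp add: \<eta>_def g_def matrix_vector_mult_add_rdistrib inner_add_right)
    have "0 \<le> g s y" for y
    proof (cases "y = 0")
      case False
      have "g s y = norm y ^ 2 * g s (y /\<^sub>R norm y)"
        using False by (simp add: power2_eq_square field_simps flip: \<eta>_inner)
      then show ?thesis
        using False unit[of "y /\<^sub>R norm y"] by simp
    qed (simp add: g_def)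
    then have \<eta>: "pos_semidef \<eta>"
      using sa[of s] by (simp add: pos_semidef_inner \<eta>_inner self_adjoint_def) (simp add: \<eta>_def)
    have "g s v = 0"
      using unit[of v] sv by simp
    with \<eta> have "\<eta> *v v = 0"
      by (simp add: pos_semidef_null_vector \<eta>_inner)
    with \<eta> G have "0 \<le> v \<bullet> (G \<eta> *v v)"
      by (simp add: unital_generator_def)
    moreover have "G \<eta> = G (\<gamma> s)"
      using G by (simp add: unital_generator_def \<eta>_def linear_add linear_cmul)
    ultimately have increase: "0 < v \<bullet> (G (\<gamma> s) *v v) + e"
      using e by simp
    have "bounded_linear (\<lambda>A :: 'n cmat. v \<bullet> (A *v v))"
      by (intro linear_conv_bounded_linear[THEN iffD1] linearI)
        (simp_all add: matrix_vector_mult_add_rdistrib inner_add_right)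
    then have "((\<lambda>t. v \<bullet> (\<gamma> t *v v)) has_vector_derivative v \<bullet> (G (\<gamma> s) *v v)) (at s)"
      using \<gamma>' by (rule bounded_linear.has_vector_derivative)
    then have "((\<lambda>t. g t v) has_real_derivative v \<bullet> (G (\<gamma> s) *v v) + e) (at s)"
      unfolding g_def has_real_derivative_iff_has_vector_derivative
      using sv by (auto intro!: derivative_eq_intros simp: dot_square_norm)
    \<comment> \<open>A positive derivative at a zero makes \<open>g\<close> negative just before
      \<open>s\<close>, against the choice of \<open>s\<close> as the earliest failure. The minimum
      in \<open>h\<close> keeps \<open>s - h\<close> non-negative.\<close>
    from DERIV_pos_inc_left[OF this increase]
    obtain d where d: "0 < d" "\<And>h. 0 < h \<Longrightarrow> h < d \<Longrightarrow> g (s - h) v < g s v"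
      by blast
    define h where "h = min (d / 2) s"
    have "g (s - h) v < 0"
      using d(2)[of h] \<open>0 < s\<close> \<open>0 < d\<close> \<open>g s v = 0\<close> by (simp add: h_def)
    moreover have "0 < g (s - h) v"
      using before[of "s - h" v] sv \<open>0 < s\<close> \<open>0 < d\<close> by (simp add: h_def)
    ultimately show False
      by simp
  qed
  have unit: "0 \<le> u \<bullet> (\<gamma> T *v u)" if "norm u = 1" for u
  proof (rule field_le_epsilon)
    fix e :: real assume "0 < e"
    then show "0 \<le> u \<bullet> (\<gamma> T *v u) + e"
      \<comment> \<open>This choice makes the perturbation at time \<open>T\<close> exactly
        \<open>e\<close>, which is then arbitrary.\<close>
      using perturbed[of "e / (1 + T)" u] that T by simp
  qed
  have "0 \<le> y \<bullet> (\<gamma> T *v y)" for y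
  proof (cases "y = 0")
    case False
    have "y \<bullet> (\<gamma> T *v y) = norm y ^ 2 * ((y /\<^sub>R norm y) \<bullet> (\<gamma> T *v (y /\<^sub>R norm y)))"
      using False by (simp add: power2_eq_square field_simps)
    then show ?thesis
      using False unit[of "y /\<^sub>R norm y"] by (metis mult_nonneg_nonneg norm_sgn sgn_div_norm zero_le_power2)
  qed simp
  then show ?thesis
    using sa by (simp add: pos_semidef_inner)
qed

section \<open>The LaSalle conditions\<close>

lemma lasalle_function_unital_generator:
  fixes G :: "'n::finite cmat \<Rightarrow> 'n cmat"
  assumes G: "unital_generator G"
  shows "lasalle_function G (\<lambda>\<xi>. 1 / 2 * Re (trace (\<xi> ** \<xi>)))"
proof -
  let ?F = "\<lambda>\<xi> :: 'n cmat. 1 / 2 * Re (trace (\<xi> ** \<xi>))"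
  have lin: "linear G"
    using G by (simp add: unital_generator_def)
  have F: "?F \<xi> = 1 / 2 * (\<xi> \<bullet> \<xi>)" if "self_adjoint \<xi>" for \<xi>
    using that by (simp add: self_adjoint_inner_trace)
  have "smooth_on trace_one G"
    using lin Ck_on_bounded_linear by (auto simp: smooth_on_def linear_conv_bounded_linear)
  moreover have "G \<xi> \<in> {x - y | x y. x \<in> trace_one \<and> y \<in> trace_one}" if "\<xi> \<in> trace_one" for \<xi>
  proof -
    \<comment> \<open>Tangency: \<open>G \<xi>\<close> is the difference of this point and
      \<open>\<xi>\<close>.\<close>
    have "\<xi> + G \<xi> \<in> trace_one"
      using that G by (simp add: unital_generator_def trace_one_def trace_add self_adjoint_def)
    with that show ?thesis
      by (force intro: exI[of _ "\<xi> + G \<xi>"])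
  qed
  ultimately have "smooth_vector_field_on trace_one G"
    by (auto simp: smooth_vector_field_on_def)
  moreover have "complete_on trace_one G"
    unfolding complete_on_def
  proof
    fix \<xi> :: "'n cmat" assume \<xi>: "\<xi> \<in> trace_one"
    \<comment> \<open>\<open>W\<close> is the direction space of \<open>trace_one\<close>; the
      integral curve stays in the coset of \<open>\<xi>\<close>.\<close>
    define W where "W = {A :: 'n cmat. self_adjoint A \<and> trace A = 0}"
    have "subspace W"
      by (auto simp: W_def subspace_def self_adjoint_def trace_add trace_def[of 0])
    moreover have "G A \<in> W" if "A - \<xi> \<in> W" for A
    proof -
      have "self_adjoint A"
        using that \<xi> by (simp add: W_def trace_one_def self_adjoint_def)
      then show ?thesis
        using G by (simp add: W_def unital_generator_def)
    qed
    ultimately obtain \<gamma> where \<gamma>: "\<gamma> 0 = \<xi>" "\<And>t. (\<gamma> has_vector_derivative G (\<gamma> t)) (at t)"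
      "\<And>t. \<gamma> t - \<xi> \<in> W"
      using linear_field_integral_curve[OF lin] by blast
    have "\<gamma> t \<in> trace_one" for t
      using \<gamma>(3)[of t] \<xi> by (simp add: W_def trace_one_def self_adjoint_def trace_sub)
    with \<gamma> show "\<exists>\<gamma>. integral_curve_on trace_one G \<gamma> \<and> \<gamma> 0 = \<xi>"
      by (auto simp: integral_curve_on_def)
  qed
  moreover have "flow_preserves trace_one G states"
    using unital_generator_preserves_pos[OF G]
    by (auto simp: flow_preserves_def integral_curve_on_def states_def trace_one_def)
  moreover have "smooth_on trace_one ?F"
    by (rule smooth_on_cong[OF smooth_on_inner_self[of _ "1 / 2"]]) (use F in \<open>simp add: trace_one_def\<close>)
  moreover have "0 \<le> ?F \<xi>" if "\<xi> \<in> states" for \<xi>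
    using that by (subst F) (auto simp: states_def trace_one_def)
  moreover have "lie_derivative G ?F \<xi> \<le> 0" if "\<xi> \<in> states" for \<xi>
  proof -
    have \<xi>: "self_adjoint \<xi>"
      using that by (simp add: states_def trace_one_def)
    then have "self_adjoint (\<xi> + t *\<^sub>R G \<xi>)" for t
      using G by (simp add: unital_generator_def self_adjoint_def)
    then have "?F (\<xi> + t *\<^sub>R G \<xi>)
        = 1 / 2 * (\<xi> \<bullet> \<xi>) + t * (\<xi> \<bullet> G \<xi>) + 1 / 2 * t\<^sup>2 * (G \<xi> \<bullet> G \<xi>)" for t
      by (simp only: F) (simp add: inner_add_left inner_add_right inner_commute power2_eq_square
          algebra_simps)
    moreover have "((\<lambda>t. 1 / 2 * (\<xi> \<bullet> \<xi>) + t * (\<xi> \<bullet> G \<xi>) + 1 / 2 * t\<^sup>2 * (G \<xi> \<bullet> G \<xi>))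
        has_real_derivative \<xi> \<bullet> G \<xi>) (at 0)"
      by (auto intro!: derivative_eq_intros)
    ultimately have "lie_derivative G ?F \<xi> = \<xi> \<bullet> G \<xi>"
      by (simp only: lie_derivative_def DERIV_imp_deriv)
    then show ?thesis
      using G \<xi> by (simp add: unital_generator_def)
  qed
  ultimately show ?thesis
    by (simp add: lasalle_function_def)
qed

theorem proposition12:
  fixes H :: "complex ^ 'n::finite ^ 'n"
    and w U :: "nat \<Rightarrow> complex ^ 'n ^ 'n"
    and \<alpha> p :: "nat \<Rightarrow> real"
    and \<beta> :: real
    and r :: nat
  assumes "self_adjoint H"
    and "\<And>j. j \<in> {1..CARD('n)^2 - 1} \<Longrightarrow> 0 \<le> \<alpha> j"
    and "0 \<le> \<beta>"
    and "r \<le> CARD('n)^2 - 1"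
    and "\<And>j. j \<in> {1..r} \<Longrightarrow> 0 \<le> p j"
    and "(\<Sum>j = 1..r. p j) = 1"
    and "\<And>j. j \<in> {1..CARD('n)^2 - 1} \<Longrightarrow> self_adjoint (w j)"
    and "\<And>j k. j \<in> {1..CARD('n)^2 - 1} \<Longrightarrow> k \<in> {1..CARD('n)^2 - 1} \<Longrightarrow>
           trace (w j ** w k) = (if j = k then 1 else 0)"
    and "\<And>j. j \<in> {1..r} \<Longrightarrow> unitary (U j)"
  shows "lasalle_function (random_unitary_generator H \<alpha> w \<beta> r p U)
           (\<lambda>\<xi>. 1 / 2 * Re (trace (\<xi> ** \<xi>)))"
proof -
  let ?J = "{1..CARD('n)^2 - 1}"
  \<comment> \<open>The summand \<open>\<beta> *\<^sub>R mat 1\<close> of \<open>V\<close>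
    contributes \<open>- \<beta> *\<^sub>R \<xi>\<close>, which is split with weights
    \<open>p j\<close> among the unitary terms; each \<open>w j ** w j\<close> joins its own
    sandwich term.\<close>
  define G where "G \<xi> = - (2 *\<^sub>R lie_prod H \<xi>)
      + (\<Sum>j\<in>?J. \<alpha> j *\<^sub>R (w j ** \<xi> ** w j - (w j ** w j) \<odot> \<xi>))
      + \<beta> *\<^sub>R (\<Sum>j = 1..r. p j *\<^sub>R (U j ** \<xi> ** dagger (U j) - \<xi>))" for \<xi>
  have gen: "unital_generator G"
    unfolding G_def
    by (intro unital_generator_add unital_generator_sum unital_generator_scaleR
        unital_generator_hamiltonian unital_generator_double_commutator unital_generator_unitary assms)
  have "random_unitary_generator H \<alpha> w \<beta> r p U \<xi> = G \<xi>" for \<xi>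
  proof -
    have "(\<Sum>j = 1..r. p j *\<^sub>R \<xi>) = \<xi>"
      using assms(6) by (simp flip: scaleR_sum_left)
    then show ?thesis
      by (simp add: random_unitary_generator_def G_def jordan_prod_simps scaleR_diff_right sum_subtractf)
  qed
  then have "random_unitary_generator H \<alpha> w \<beta> r p U = G"
    by (rule ext)
  with gen show ?thesis
    using lasalle_function_unital_generator[of G] by simp
qed

end
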